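(* Let $\Sigma_F=(M,F^2,Fe)$ be a Finslerian mechanical system. The variation of the kinetic energy $\mathcal E_{F^2}=F^2$ along the evolution curves $t\mapsto x(t)$ of $\Sigma_F$ is given by $$\frac{d\mathcal E_{F^2}}{dt}=\frac{dx^i}{dt}F_i,$$ where $\mathcal E_{F^2}$ and $F_i$ are evaluated at $\left(x(t),\frac{dx}{dt}(t)\right)$.
   Context: The summation convention is used. $M$ is a real $n$-dimensional smooth manifold, $(x^i,y^i)$ are the induced coordinates on $TM$, and $\widetilde{TM}$ is $TM$ with the zero section removed. A (possibly semidefinite) Finsler space $F^n=(M,F)$ is given by a function $F:TM\to\mathbb R$, $F\ge 0$, smooth on $\widetilde{TM}$ and continuous on the zero section, positively 1-homogeneous in $y$, such that $g_{ij}=\frac12\frac{\partial^2F^2}{\partial y^i\partial y^j}$ is nonsingular and of constant signature on $\widetilde{TM}$. Its energy is $\mathcal E_{F^2}=y^i\frac{\partial F^2}{\partial y^i}-F^2=F^2$. A Finslerian mechanical system is a triple $\Sigma_F=(M,F^2,Fe)$, where $Fe=F^i(x,y)\frac{\partial}{\partial y^i}$ is a given vertical vector field on $TM$ (external forces), with covariant components $F_i=g_{ij}F^j$. The evolution curves are the curves $x(t)$ in $M$ (with extension $(x,\dot x)$ in $\widetilde{TM}$) satisfying the Lagrange equations $$\frac{d}{dt}\frac{\partial F^2}{\partial y^i}-\frac{\partial F^2}{\partial x^i}=F_i(x,y),\qquad y^i=\frac{dx^i}{dt}.$$ *)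

theory Defs
  imports "HOL-Analysis.Analysis"
begin

section \<open>Smooth maps and smooth manifolds\<close>

text \<open>\<open>Ck_on k f S\<close> is used for open \<open>S\<close> only, where all Frechet derivatives below are unique.\<close>

primrec Ck_on :: "nat \<Rightarrow> ('a::real_normed_vector \<Rightarrow> 'b::real_normed_vector) \<Rightarrow> 'a set \<Rightarrow> bool" where
  "Ck_on 0 f S \<longleftrightarrow> continuous_on S f"
| "Ck_on (Suc k) f S \<longleftrightarrow>
     f differentiable_on S \<and> (\<forall>v. Ck_on k (\<lambda>x. frechet_derivative f (at x) v) S)"

definition smooth_on :: "('a::real_normed_vector \<Rightarrow> 'b::real_normed_vector) \<Rightarrow> 'a set \<Rightarrow> bool" where
  "smooth_on f S \<longleftrightarrow> (\<forall>k. Ck_on k f S)"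

text \<open>A chart is a pair of its domain and its coordinate map; the values of the map outside
  the domain are irrelevant.\<close>

type_synonym ('a, 'b) chart = "'a set \<times> ('a \<Rightarrow> 'b)"

definition chart_inv :: "('a, 'b) chart \<Rightarrow> 'b \<Rightarrow> 'a" where
  "chart_inv c = inv_into (fst c) (snd c)"

definition transition :: "('a, 'b) chart \<Rightarrow> ('a, 'b) chart \<Rightarrow> 'b \<Rightarrow> 'b" where
  "transition c d = snd d \<circ> chart_inv c"

definition smooth_manifold :: "'a topology \<Rightarrow> ('a, 'b::euclidean_space) chart set \<Rightarrow> bool" where
  "smooth_manifold X A \<longleftrightarrow>
     Hausdorff_space X \<and> second_countable X \<and> (\<Union>c\<in>A. fst c) = topspace X \<and>
     (\<forall>c\<in>A. openin X (fst c) \<and> open (snd c ` fst c) \<and>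
        homeomorphic_map (subtopology X (fst c)) (top_of_set (snd c ` fst c)) (snd c)) \<and>
     (\<forall>c\<in>A. \<forall>d\<in>A. smooth_on (transition c d) (snd c ` (fst c \<inter> fst d)))"

section \<open>Tangent bundle\<close>

text \<open>A tangent vector at \<open>p\<close> is the family of its component vectors in all charts of the atlas
  around \<open>p\<close>, which transform by the Jacobian of the change of coordinates. Indices that are not
  charts around \<open>p\<close> get the value 0, so that a tangent vector is determined by its components.\<close>

type_synonym ('a, 'b) tvec = "('a, 'b) chart \<Rightarrow> 'b"
type_synonym ('a, 'b) tpoint = "'a \<times> ('a, 'b) tvec"

definition tangent_space :: "('a, 'b::euclidean_space) chart set \<Rightarrow> 'a \<Rightarrow> ('a, 'b) tvec set" where
  "tangent_space A p =
     {v. (\<forall>c\<in>A. \<forall>d\<in>A. p \<in> fst c \<longrightarrow> p \<in> fst d \<longrightarrow>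
            v d = frechet_derivative (transition c d) (at (snd c p)) (v c)) \<and>
         (\<forall>c. \<not> (c \<in> A \<and> p \<in> fst c) \<longrightarrow> v c = 0)}"

definition tangent_bundle :: "('a, 'b::euclidean_space) chart set \<Rightarrow> ('a, 'b) tpoint set" where
  "tangent_bundle A = (SIGMA p : (\<Union>c\<in>A. fst c). tangent_space A p)"

definition slit_tangent_bundle ::
    "('a, 'b::euclidean_space) chart set \<Rightarrow> ('a, 'b) tpoint set" where
  "slit_tangent_bundle A = {u \<in> tangent_bundle A. snd u \<noteq> (\<lambda>_. 0)}"

text \<open>The chart of the tangent bundle given by the induced coordinates \<open>(x, y)\<close>.\<close>

definition induced_chart :: "('a, 'b::euclidean_space) chart set \<Rightarrow> ('a, 'b) chart \<Rightarrow>
    (('a, 'b) tpoint, 'b \<times> 'b) chart" where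
  "induced_chart A c =
     ({u \<in> tangent_bundle A. fst u \<in> fst c}, \<lambda>u. (snd c (fst u), snd u c))"

text \<open>A function on the tangent bundle in induced coordinates. It is only meaningful on the image of
  the induced chart, which is open, so that derivatives at its points are not affected by the
  values elsewhere.\<close>

definition local_rep :: "('a, 'b::euclidean_space) chart set \<Rightarrow> ('a, 'b) chart \<Rightarrow>
    (('a, 'b) tpoint \<Rightarrow> 'r) \<Rightarrow> 'b \<times> 'b \<Rightarrow> 'r" where
  "local_rep A c f = f \<circ> chart_inv (induced_chart A c)"

definition continuous_on_TM :: "('a, 'b::euclidean_space) chart set \<Rightarrow>
    (('a, 'b) tpoint \<Rightarrow> 'r::real_normed_vector) \<Rightarrow> bool" where
  "continuous_on_TM A f \<longleftrightarrow>
     (\<forall>c\<in>A. continuous_on (snd (induced_chart A c) ` fst (induced_chart A c)) (local_rep A c f))"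

definition smooth_on_slit_in_chart :: "('a, 'b::euclidean_space) chart set \<Rightarrow>
    ('a, 'b) chart \<Rightarrow> (('a, 'b) tpoint \<Rightarrow> 'r::real_normed_vector) \<Rightarrow> bool" where
  "smooth_on_slit_in_chart A c f \<longleftrightarrow>
     smooth_on (local_rep A c f)
       (snd (induced_chart A c) ` (fst (induced_chart A c) \<inter> slit_tangent_bundle A))"

text \<open>\<open>\<partial>f/\<partial>x\<^sup>i\<close> and \<open>\<partial>f/\<partial>y\<^sup>i\<close> in the coordinates induced by \<open>c\<close>, again as functions on the
  tangent bundle.\<close>

definition pd_x :: "('a, real^'n) chart set \<Rightarrow> ('a, real^'n) chart \<Rightarrow> 'n::finite \<Rightarrow>
    (('a, real^'n) tpoint \<Rightarrow> real) \<Rightarrow> ('a, real^'n) tpoint \<Rightarrow> real" where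
  "pd_x A c i f u =
     frechet_derivative (local_rep A c f) (at (snd (induced_chart A c) u)) (axis i 1, 0)"

definition pd_y :: "('a, real^'n) chart set \<Rightarrow> ('a, real^'n) chart \<Rightarrow> 'n::finite \<Rightarrow>
    (('a, real^'n) tpoint \<Rightarrow> real) \<Rightarrow> ('a, real^'n) tpoint \<Rightarrow> real" where
  "pd_y A c i f u =
     frechet_derivative (local_rep A c f) (at (snd (induced_chart A c) u)) (0, axis i 1)"

section \<open>Finsler spaces\<close>

text \<open>The maximal dimension of a subspace on which the quadratic form of \<open>M\<close> is positive
  definite; for symmetric \<open>M\<close> the number of positive entries in its Sylvester normal form.\<close>

definition positive_index :: "real^'n^'n \<Rightarrow> nat" where
  "positive_index M = Max (dim ` {S. subspace S \<and> (\<forall>v\<in>S - {0}. 0 < v \<bullet> (M *v v))})"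

definition signature_of :: "real^'n^'n \<Rightarrow> nat \<times> nat" where
  "signature_of M = (positive_index M, positive_index (- M))"

definition finsler_metric :: "('a, real^'n) chart set \<Rightarrow> (('a, real^'n) tpoint \<Rightarrow> real) \<Rightarrow>
    ('a, real^'n) chart \<Rightarrow> ('a, real^'n) tpoint \<Rightarrow> real^'n^'n" where
  "finsler_metric A F c u = (\<chi> i j. 1/2 * pd_y A c i (pd_y A c j (\<lambda>w. (F w)\<^sup>2)) u)"

definition finsler_space :: "'a topology \<Rightarrow> ('a, real^'n) chart set \<Rightarrow>
    (('a, real^'n) tpoint \<Rightarrow> real) \<Rightarrow> bool" where
  "finsler_space X A F \<longleftrightarrow>
     smooth_manifold X A \<and>
     (\<forall>u\<in>tangent_bundle A. 0 \<le> F u) \<and>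
     (\<forall>c\<in>A. smooth_on_slit_in_chart A c F) \<and>
     continuous_on_TM A F \<and>
     (\<forall>(p, v)\<in>tangent_bundle A. \<forall>r>0. F (p, \<lambda>c. r *\<^sub>R v c) = r * F (p, v)) \<and>
     (\<forall>c\<in>A. \<forall>u\<in>slit_tangent_bundle A. fst u \<in> fst c \<longrightarrow> invertible (finsler_metric A F c u)) \<and>
     (\<exists>s. \<forall>c\<in>A. \<forall>u\<in>slit_tangent_bundle A. fst u \<in> fst c \<longrightarrow>
        signature_of (finsler_metric A F c u) = s)"

definition energy :: "('a, real^'n) chart set \<Rightarrow> (('a, real^'n) tpoint \<Rightarrow> real) \<Rightarrow>
    ('a, real^'n) chart \<Rightarrow> ('a, real^'n) tpoint \<Rightarrow> real" where
  "energy A L c u = (\<Sum>i\<in>UNIV. snd u c $ i * pd_y A c i L u) - L u"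

section \<open>Finslerian mechanical systems\<close>

text \<open>Tangent vectors of the tangent bundle are taken with respect to the atlas of induced charts;
  in the chart induced by \<open>c\<close>, \<open>fst\<close> and \<open>snd\<close> of such a vector are its components along
  \<open>\<partial>/\<partial>x\<close> and \<open>\<partial>/\<partial>y\<close>. Vertical means that the former vanish.\<close>

definition vertical_field :: "('a, real^'n) chart set \<Rightarrow>
    (('a, real^'n) tpoint \<Rightarrow> (('a, real^'n) tpoint, (real^'n) \<times> (real^'n)) tvec) \<Rightarrow> bool" where
  "vertical_field A Fe \<longleftrightarrow>
     (\<forall>u\<in>tangent_bundle A. Fe u \<in> tangent_space (induced_chart A ` A) u \<and>
        (\<forall>c\<in>A. fst u \<in> fst c \<longrightarrow> fst (Fe u (induced_chart A c)) = 0)) \<and>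
     (\<forall>c\<in>A. smooth_on_slit_in_chart A c (\<lambda>u. Fe u (induced_chart A c)))"

definition force_contra :: "('a, real^'n) chart set \<Rightarrow>
    (('a, real^'n) tpoint \<Rightarrow> (('a, real^'n) tpoint, (real^'n) \<times> (real^'n)) tvec) \<Rightarrow>
    ('a, real^'n) chart \<Rightarrow> 'n::finite \<Rightarrow> ('a, real^'n) tpoint \<Rightarrow> real" where
  "force_contra A Fe c i u = snd (Fe u (induced_chart A c)) $ i"

definition force_cov :: "('a, real^'n) chart set \<Rightarrow> (('a, real^'n) tpoint \<Rightarrow> real) \<Rightarrow>
    (('a, real^'n) tpoint \<Rightarrow> (('a, real^'n) tpoint, (real^'n) \<times> (real^'n)) tvec) \<Rightarrow>
    ('a, real^'n) chart \<Rightarrow> 'n::finite \<Rightarrow> ('a, real^'n) tpoint \<Rightarrow> real" where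
  "force_cov A F Fe c i u = (\<Sum>j\<in>UNIV. finsler_metric A F c u $ i $ j * force_contra A Fe c j u)"

definition finslerian_mechanical_system :: "'a topology \<Rightarrow> ('a, real^'n) chart set \<Rightarrow>
    (('a, real^'n) tpoint \<Rightarrow> real) \<Rightarrow>
    (('a, real^'n) tpoint \<Rightarrow> (('a, real^'n) tpoint, (real^'n) \<times> (real^'n)) tvec) \<Rightarrow> bool" where
  "finslerian_mechanical_system X A F Fe \<longleftrightarrow> finsler_space X A F \<and> vertical_field A Fe"

section \<open>Evolution curves\<close>

definition C2_curve :: "'a topology \<Rightarrow> ('a, 'b::euclidean_space) chart set \<Rightarrow> real set \<Rightarrow>
    (real \<Rightarrow> 'a) \<Rightarrow> bool" where
  "C2_curve X A I \<gamma> \<longleftrightarrow>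
     open I \<and> is_interval I \<and> continuous_map (top_of_set I) X \<gamma> \<and>
     (\<forall>c\<in>A. Ck_on 2 (snd c \<circ> \<gamma>) {t \<in> I. \<gamma> t \<in> fst c})"

definition lift :: "('a, 'b::euclidean_space) chart set \<Rightarrow> (real \<Rightarrow> 'a) \<Rightarrow> real \<Rightarrow>
    ('a, 'b) tpoint" where
  "lift A \<gamma> t =
     (\<gamma> t, \<lambda>c. if c \<in> A \<and> \<gamma> t \<in> fst c then vector_derivative (snd c \<circ> \<gamma>) (at t) else 0)"

definition evolution_curve :: "'a topology \<Rightarrow> ('a, real^'n) chart set \<Rightarrow>
    (('a, real^'n) tpoint \<Rightarrow> real) \<Rightarrow>
    (('a, real^'n) tpoint \<Rightarrow> (('a, real^'n) tpoint, (real^'n) \<times> (real^'n)) tvec) \<Rightarrow>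
    real set \<Rightarrow> (real \<Rightarrow> 'a) \<Rightarrow> bool" where
  "evolution_curve X A F Fe I \<gamma> \<longleftrightarrow>
     C2_curve X A I \<gamma> \<and>
     (\<forall>t\<in>I. lift A \<gamma> t \<in> slit_tangent_bundle A) \<and>
     (\<forall>t\<in>I. \<forall>c\<in>A. \<gamma> t \<in> fst c \<longrightarrow> (\<forall>i.
        deriv (\<lambda>s. pd_y A c i (\<lambda>w. (F w)\<^sup>2) (lift A \<gamma> s)) t - pd_x A c i (\<lambda>w. (F w)\<^sup>2) (lift A \<gamma> t)
          = force_cov A F Fe c i (lift A \<gamma> t)))"

end

theory Submission
  imports Defs
begin

text \<open>In the coordinates \<open>(x, y)\<close> induced by a chart, write \<open>L(x, y)\<close> for \<open>F\<^sup>2\<close>. Since \<open>F\<^sup>2\<close> is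
  positively homogeneous of degree two in \<open>y\<close>, differentiating \<open>L(x, r y) = r\<^sup>2 L(x, y)\<close> at \<open>r = 1\<close>
  gives \<open>y\<^sup>i \<partial>L/\<partial>y\<^sup>i = 2 L\<close>, so that the energy equals \<open>F\<^sup>2\<close>; this is \<open>energy_eq_square\<close>.
  Along a curve with \<open>y = dx/dt\<close>, differentiating \<open>y\<^sup>i \<partial>L/\<partial>y\<^sup>i - L\<close> by the product
  rule and the chain rule produces the term \<open>dy\<^sup>i/dt \<partial>L/\<partial>y\<^sup>i\<close> twice, with opposite signs, and leaves
  \<open>y\<^sup>i (d/dt \<partial>L/\<partial>y\<^sup>i - \<partial>L/\<partial>x\<^sup>i)\<close>; this is \<open>energy_derivative\<close>, a computation for an arbitrary
  Lagrangian.
  The Lagrange equations turn the bracket into \<open>F\<^sub>i\<close>.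

  What remains is to justify this calculus. All derivatives are Frechet derivatives of local
  representatives, and smoothness is assumed on the image of the slit tangent bundle under the
  induced chart. Differentiability within that image is differentiability at its points because the
  image is open. To see this, the lemma
  \<open>induced_chart_slit_image\<close> identifies it with the product of the image of the chart and the
  nonzero vectors. That every vector occurs as a fibre coordinate is the chain rule for the changes
  of coordinates: the images of one vector under the Jacobians are compatible with each other and
  form a tangent vector.\<close>

section \<open>Changes of coordinates\<close>

lemma chart_inj_on:
  assumes "smooth_manifold X A" "c \<in> A"
  shows "inj_on (snd c) (fst c)"
proof -
  have "openin X (fst c)" "homeomorphic_map (subtopology X (fst c)) (top_of_set (snd c ` fst c)) (snd c)"
    using assms unfolding smooth_manifold_def by auto
  then show ?thesis
    using homeomorphic_eq_everything_map[of "subtopology X (fst c)"] openin_subset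
    by (metis topspace_subtopology_subset)
qed

lemma chart_inv_apply:
  assumes "smooth_manifold X A" "c \<in> A" "p \<in> fst c"
  shows "chart_inv c (snd c p) = p"
  using chart_inj_on[OF assms(1,2)] assms(3) by (simp add: chart_inv_def)

lemma transition_apply:
  assumes "smooth_manifold X A" "c \<in> A" "p \<in> fst c"
  shows "transition c d (snd c p) = snd d p"
  by (simp add: transition_def chart_inv_apply[OF assms])

lemma open_chart_image:
  assumes "smooth_manifold X A" "c \<in> A" "openin X V" "V \<subseteq> fst c"
  shows "open (snd c ` V)"
proof -
  have c: "open (snd c ` fst c)"
    "homeomorphic_map (subtopology X (fst c)) (top_of_set (snd c ` fst c)) (snd c)"
    using assms(1,2) unfolding smooth_manifold_def by auto
  have "openin (subtopology X (fst c)) V"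
    using assms(3,4) by (auto simp: openin_subtopology)
  then have "openin (top_of_set (snd c ` fst c)) (snd c ` V)"
    using homeomorphic_imp_open_map[OF c(2)] by (simp add: open_map_def)
  then show ?thesis
    using c(1) openin_open_trans by blast
qed

lemma openin_chart_domain:
  assumes "smooth_manifold X A" "c \<in> A"
  shows "openin X (fst c)"
  using assms unfolding smooth_manifold_def by auto

lemma Ck_on_Suc_has_derivative:
  assumes "Ck_on (Suc k) f S" "open S" "x \<in> S"
  shows "(f has_derivative frechet_derivative f (at x)) (at x)"
  using assms by (simp add: differentiable_on_eq_differentiable_at flip: frechet_derivative_works)

lemma Ck_on_Suc_directional:
  "Ck_on (Suc k) f S \<Longrightarrow> Ck_on k (\<lambda>x. frechet_derivative f (at x) v) S"
  by simp

lemma transition_has_derivative: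
  assumes "smooth_manifold X A" "c \<in> A" "d \<in> A" "p \<in> fst c" "p \<in> fst d"
  shows "(transition c d has_derivative frechet_derivative (transition c d) (at (snd c p)))
    (at (snd c p))"
proof (rule Ck_on_Suc_has_derivative)
  show "Ck_on (Suc 0) (transition c d) (snd c ` (fst c \<inter> fst d))"
    using assms(1-3) unfolding smooth_manifold_def smooth_on_def by blast
  show "open (snd c ` (fst c \<inter> fst d))"
    using assms(1-3) by (intro open_chart_image) (auto intro: openin_chart_domain)
  show "snd c p \<in> snd c ` (fst c \<inter> fst d)"
    using assms(4,5) by blast
qed

text \<open>Near \<open>snd c p\<close> the change of coordinates from \<open>c\<close> to \<open>e\<close> factors through \<open>d\<close>; this is the
  chain rule for the factorisation.\<close>

lemma transition_cocycle:
  assumes "smooth_manifold X A" "c \<in> A" "d \<in> A" "e \<in> A" "p \<in> fst c" "p \<in> fst d" "p \<in> fst e"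
  shows "frechet_derivative (transition c e) (at (snd c p)) y =
    frechet_derivative (transition d e) (at (snd d p))
      (frechet_derivative (transition c d) (at (snd c p)) y)"
proof -
  let ?V = "fst c \<inter> fst d \<inter> fst e"
  have cd: "(transition c d has_derivative frechet_derivative (transition c d) (at (snd c p)))
      (at (snd c p))"
    using assms by (intro transition_has_derivative) auto
  have "(transition d e has_derivative frechet_derivative (transition d e) (at (snd d p)))
      (at (transition c d (snd c p)))"
    using transition_has_derivative[of X A d e p] assms by (simp add: transition_apply)
  from has_derivative_compose[OF cd this]
  have "((\<lambda>x. transition d e (transition c d x)) has_derivative
      (\<lambda>y. frechet_derivative (transition d e) (at (snd d p))
        (frechet_derivative (transition c d) (at (snd c p)) y))) (at (snd c p))" .
  then have "(transition c e has_derivative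
      (\<lambda>y. frechet_derivative (transition d e) (at (snd d p))
        (frechet_derivative (transition c d) (at (snd c p)) y))) (at (snd c p))"
  proof (rule has_derivative_transform_within_open)
    show "open (snd c ` ?V)"
      using assms by (intro open_chart_image) (auto intro!: openin_Int openin_chart_domain)
    show "transition d e (transition c d x) = transition c e x" if "x \<in> snd c ` ?V" for x
      using that assms by (auto simp: transition_apply)
  qed (use assms in auto)
  from frechet_derivative_at[OF this] show ?thesis by metis
qed

lemma transition_self_derivative:
  assumes "smooth_manifold X A" "c \<in> A" "p \<in> fst c"
  shows "frechet_derivative (transition c c) (at (snd c p)) y = y"
proof -
  have "((\<lambda>x. x) has_derivative (\<lambda>y. y)) (at (snd c p))" by simp
  then have "(transition c c has_derivative (\<lambda>y. y)) (at (snd c p))"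
  proof (rule has_derivative_transform_within_open)
    show "open (snd c ` fst c)"
      using assms by (intro open_chart_image) (auto intro: openin_chart_domain)
    show "x = transition c c x" if "x \<in> snd c ` fst c" for x
      using that assms by (auto simp: transition_apply)
  qed (use assms in auto)
  from frechet_derivative_at[OF this] show ?thesis by metis
qed

section \<open>The tangent bundle in induced coordinates\<close>

lemma tangent_spaceI:
  assumes "\<And>c d. c \<in> A \<Longrightarrow> d \<in> A \<Longrightarrow> p \<in> fst c \<Longrightarrow> p \<in> fst d \<Longrightarrow>
      v d = frechet_derivative (transition c d) (at (snd c p)) (v c)"
    and "\<And>c. \<not> (c \<in> A \<and> p \<in> fst c) \<Longrightarrow> v c = 0"
  shows "v \<in> tangent_space A p"
  unfolding tangent_space_def mem_Collect_eq by (intro conjI ballI allI impI) (fact assms)+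

lemma tangent_space_transform:
  assumes "v \<in> tangent_space A p" "c \<in> A" "d \<in> A" "p \<in> fst c" "p \<in> fst d"
  shows "v d = frechet_derivative (transition c d) (at (snd c p)) (v c)"
proof -
  have "\<forall>c\<in>A. \<forall>d\<in>A. p \<in> fst c \<longrightarrow> p \<in> fst d \<longrightarrow>
      v d = frechet_derivative (transition c d) (at (snd c p)) (v c)"
    using assms(1) unfolding tangent_space_def mem_Collect_eq by (rule conjunct1)
  from this[rule_format, OF assms(2-)] show ?thesis .
qed

lemma tangent_space_outside:
  assumes "v \<in> tangent_space A p" "\<not> (c \<in> A \<and> p \<in> fst c)"
  shows "v c = 0"
proof -
  have "\<forall>c. \<not> (c \<in> A \<and> p \<in> fst c) \<longrightarrow> v c = 0"
    using assms(1) unfolding tangent_space_def mem_Collect_eq by (rule conjunct2)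
  then show ?thesis
    using assms(2) by blast
qed

lemma tangent_space_scale:
  assumes "smooth_manifold X A" "v \<in> tangent_space A p"
  shows "(\<lambda>c. r *\<^sub>R v c) \<in> tangent_space A p"
proof (rule tangent_spaceI)
  show "r *\<^sub>R v d =
      frechet_derivative (transition c d) (at (snd c p)) (r *\<^sub>R v c)"
    if "c \<in> A" "d \<in> A" "p \<in> fst c" "p \<in> fst d" for c d
    using transition_has_derivative[OF assms(1) that] tangent_space_transform[OF assms(2) that]
    by (simp add: has_derivative_bounded_linear linear_simps(5))
  show "r *\<^sub>R v c = 0" if "\<not> (c \<in> A \<and> p \<in> fst c)" for c
    using tangent_space_outside[OF assms(2) that] by simp
qed

text \<open>The components in one chart determine all the others through the Jacobians. Applied to the
  zero vector, this makes nonzero tangent vectors have nonzero components in every chart.\<close>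

lemma tangent_vector_eqI:
  assumes "v \<in> tangent_space A p" "w \<in> tangent_space A p"
    and "c \<in> A" "p \<in> fst c" "v c = w c"
  shows "v = w"
proof
  fix d
  show "v d = w d"
  proof (cases "d \<in> A \<and> p \<in> fst d")
    case True
    then have d: "d \<in> A" "p \<in> fst d" by auto
    have "v d = frechet_derivative (transition c d) (at (snd c p)) (v c)"
      by (rule tangent_space_transform[OF assms(1,3) d(1) assms(4) d(2)])
    also have "\<dots> = w d"
      unfolding assms(5) by (rule tangent_space_transform[OF assms(2,3) d(1) assms(4) d(2), symmetric])
    finally show ?thesis .
  next
    case False
    then show ?thesis
      using tangent_space_outside[OF assms(1)] tangent_space_outside[OF assms(2)] by simp
  qed
qed

text \<open>The Jacobians carry the components \<open>y\<close> from \<open>c\<close> to every other chart, and the cocycle identity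
  makes the results compatible.\<close>

lemma tangent_vector_exists:
  assumes "smooth_manifold X A" "c \<in> A" "p \<in> fst c"
  obtains v where "v \<in> tangent_space A p" "v c = y"
proof
  let ?v = "\<lambda>d. if d \<in> A \<and> p \<in> fst d
    then frechet_derivative (transition c d) (at (snd c p)) y else 0"
  show "?v \<in> tangent_space A p"
  proof (rule tangent_spaceI)
    show "?v e = frechet_derivative (transition d e) (at (snd d p)) (?v d)"
      if "d \<in> A" "e \<in> A" "p \<in> fst d" "p \<in> fst e" for d e
      using that transition_cocycle[OF assms(1,2) that(1,2) assms(3) that(3,4)] by simp
  qed auto
  show "?v c = y"
    using assms by (simp add: transition_self_derivative)
qed

lemma zero_tangent_vector:
  assumes "smooth_manifold X A" "p \<in> (\<Union>c\<in>A. fst c)"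
  shows "(\<lambda>_. 0) \<in> tangent_space A p"
proof -
  obtain c where "c \<in> A" "p \<in> fst c" using assms(2) by auto
  then obtain v where "v \<in> tangent_space A p"
    using tangent_vector_exists[OF assms(1)] by metis
  from tangent_space_scale[OF assms(1) this, of 0] show ?thesis by simp
qed

lemma induced_chart_inj_on:
  assumes "smooth_manifold X A" "c \<in> A"
  shows "inj_on (snd (induced_chart A c)) (fst (induced_chart A c))"
proof (rule inj_onI)
  fix u w
  assume uw: "u \<in> fst (induced_chart A c)" "w \<in> fst (induced_chart A c)"
    "snd (induced_chart A c) u = snd (induced_chart A c) w"
  have "fst u = fst w"
    using uw chart_inj_on[OF assms] by (auto simp: induced_chart_def dest: inj_onD)
  moreover have "snd u = snd w"
    using uw \<open>fst u = fst w\<close> assms(2)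
    by (intro tangent_vector_eqI[of "snd u" A "fst u" "snd w" c])
       (auto simp: induced_chart_def tangent_bundle_def)
  ultimately show "u = w" by (simp add: prod_eq_iff)
qed

lemma local_rep_induced_chart:
  assumes "smooth_manifold X A" "c \<in> A" "u \<in> tangent_bundle A" "fst u \<in> fst c"
  shows "local_rep A c f (snd (induced_chart A c) u) = f u"
proof -
  have "u \<in> fst (induced_chart A c)"
    using assms by (simp add: induced_chart_def)
  then show ?thesis
    using induced_chart_inj_on[OF assms(1,2)] by (simp add: local_rep_def chart_inv_def)
qed

lemma induced_chart_slit_image:
  assumes "smooth_manifold X A" "c \<in> A"
  shows "snd (induced_chart A c) ` (fst (induced_chart A c) \<inter> slit_tangent_bundle A) =
    (snd c ` fst c) \<times> (- {0})"
proof (intro equalityI subsetI)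
  fix z assume "z \<in> snd (induced_chart A c) ` (fst (induced_chart A c) \<inter> slit_tangent_bundle A)"
  then obtain u where u: "z = (snd c (fst u), snd u c)" "fst u \<in> fst c" "u \<in> tangent_bundle A"
    "snd u \<noteq> (\<lambda>_. 0)"
    by (auto simp: induced_chart_def slit_tangent_bundle_def)
  have "snd u c \<noteq> 0"
  proof
    assume "snd u c = 0"
    moreover have "(\<lambda>_. 0) \<in> tangent_space A (fst u)"
      using zero_tangent_vector[OF assms(1)] assms(2) u(2) by blast
    moreover have "snd u \<in> tangent_space A (fst u)"
      using u(3) by (auto simp: tangent_bundle_def)
    ultimately show False
      using tangent_vector_eqI[OF _ _ assms(2) u(2), of "snd u" "\<lambda>_. 0"] u(4) by simp
  qed
  then show "z \<in> (snd c ` fst c) \<times> (- {0})"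
    using u by auto
next
  fix z assume "z \<in> (snd c ` fst c) \<times> (- {0 :: 'b})"
  then obtain p y where z: "z = (snd c p, y)" "p \<in> fst c" "y \<noteq> 0" by auto
  obtain v where v: "v \<in> tangent_space A p" "v c = y"
    using tangent_vector_exists[OF assms z(2)] .
  have "(p, v) \<in> fst (induced_chart A c) \<inter> slit_tangent_bundle A"
    using v z assms by (auto simp: induced_chart_def slit_tangent_bundle_def tangent_bundle_def)
  moreover have "z = snd (induced_chart A c) (p, v)"
    using v z by (simp add: induced_chart_def)
  ultimately show "z \<in> snd (induced_chart A c) ` (fst (induced_chart A c) \<inter> slit_tangent_bundle A)"
    by blast
qed

lemma open_induced_chart_slit_image:
  assumes "smooth_manifold X A" "c \<in> A"
  shows "open (snd (induced_chart A c) ` (fst (induced_chart A c) \<inter> slit_tangent_bundle A))"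
  unfolding induced_chart_slit_image[OF assms]
  using open_chart_image[OF assms openin_chart_domain[OF assms]] by (auto intro: open_Times)

lemma induced_chart_in_slit_image:
  assumes "u \<in> slit_tangent_bundle A" "fst u \<in> fst c"
  shows "snd (induced_chart A c) u
    \<in> snd (induced_chart A c) ` (fst (induced_chart A c) \<inter> slit_tangent_bundle A)"
  using assms by (auto simp: slit_tangent_bundle_def induced_chart_def)

lemma local_rep_square: "local_rep A c (\<lambda>w. (F w)\<^sup>2) = (\<lambda>z. (local_rep A c F z)\<^sup>2)"
  by (simp add: local_rep_def fun_eq_iff)

section \<open>Regularity of the square of a smooth function\<close>

lemma square_has_derivative:
  fixes f :: "'a::real_normed_vector \<Rightarrow> real"
  assumes "(f has_derivative f') (at z)"
  shows "((\<lambda>z. (f z)\<^sup>2) has_derivative (\<lambda>h. 2 * f z * f' h)) (at z)"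
  unfolding power2_eq_square
  by (rule has_derivative_eq_rhs[OF has_derivative_mult[OF assms assms]]) auto

text \<open>Smoothness is a hypothesis on \<open>F\<close>, while the Lagrangian is \<open>F\<^sup>2\<close>. The second claim says
  that the momenta \<open>\<partial>F\<^sup>2/\<partial>y\<^sup>i = 2 F \<partial>F/\<partial>y\<^sup>i\<close> can be differentiated along curves.\<close>

lemma smooth_square_differentiable:
  fixes f :: "'a::real_normed_vector \<Rightarrow> real"
  assumes "smooth_on f S" "open S" "z \<in> S"
  shows "(\<lambda>z. (f z)\<^sup>2) differentiable at z"
    and "(\<lambda>z. frechet_derivative (\<lambda>z. (f z)\<^sup>2) (at z) v) differentiable at z"
proof -
  have 2: "Ck_on (Suc (Suc 0)) f S"
    using assms(1) by (simp add: smooth_on_def del: Ck_on.simps)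
  have f: "(f has_derivative frechet_derivative f (at w)) (at w)" if "w \<in> S" for w
    using Ck_on_Suc_has_derivative[OF 2 assms(2) that] .
  show "(\<lambda>z. (f z)\<^sup>2) differentiable at z"
    using square_has_derivative[OF f[OF assms(3)]] by (rule differentiableI)
  have "Ck_on (Suc 0) (\<lambda>z. frechet_derivative f (at z) v) S"
    by (rule Ck_on_Suc_directional[OF 2])
  note df = Ck_on_Suc_has_derivative[OF this assms(2,3)]
  have "((\<lambda>z. 2 * f z * frechet_derivative f (at z) v) has_derivative
      (\<lambda>h. 2 * f z * frechet_derivative (\<lambda>z. frechet_derivative f (at z) v) (at z) h
        + 2 * frechet_derivative f (at z) h * frechet_derivative f (at z) v)) (at z)"
    by (rule has_derivative_mult[OF has_derivative_mult_right[OF f[OF assms(3)]] df])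
  then have "((\<lambda>z. frechet_derivative (\<lambda>z. (f z)\<^sup>2) (at z) v) has_derivative
      (\<lambda>h. 2 * f z * frechet_derivative (\<lambda>z. frechet_derivative f (at z) v) (at z) h
        + 2 * frechet_derivative f (at z) h * frechet_derivative f (at z) v)) (at z)"
  proof (rule has_derivative_transform_within_open[OF _ assms(2,3)])
    fix w assume "w \<in> S"
    from frechet_derivative_at[OF square_has_derivative[OF f[OF this]]]
    show "2 * f w * frechet_derivative f (at w) v = frechet_derivative (\<lambda>z. (f z)\<^sup>2) (at w) v"
      by metis
  qed
  then show "(\<lambda>z. frechet_derivative (\<lambda>z. (f z)\<^sup>2) (at z) v) differentiable at z"
    by (rule differentiableI)
qed

section \<open>Homogeneity and the energy\<close>

lemma vec_eq_sum_axis: "(\<Sum>i\<in>UNIV. y $ i *\<^sub>R axis i 1) = (y :: real^'n)"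
  using basis_expansion[of y] by (simp add: scalar_mult_eq_scaleR)

text \<open>Linearity of the Frechet derivative is what makes the partial derivatives compute it.\<close>

lemma derivative_eq_sum_partials:
  fixes L :: "(real^'n) \<times> (real^'n) \<Rightarrow> real"
  assumes "(L has_derivative D) (at z)"
  shows "D (x, y) = (\<Sum>i\<in>UNIV. x $ i * D (axis i 1, 0)) + (\<Sum>i\<in>UNIV. y $ i * D (0, axis i 1))"
proof -
  interpret D: bounded_linear D
    using assms by (rule has_derivative_bounded_linear)
  have "D (x, y) = D ((\<Sum>i\<in>UNIV. x $ i *\<^sub>R axis i 1), 0) + D (0, (\<Sum>i\<in>UNIV. y $ i *\<^sub>R axis i 1))"
    by (simp add: vec_eq_sum_axis flip: D.add)
  also have "((\<Sum>i\<in>UNIV. x $ i *\<^sub>R axis i 1), 0 :: real^'n) = (\<Sum>i\<in>UNIV. x $ i *\<^sub>R (axis i 1, 0))"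
    by (simp add: prod_eq_iff fst_sum snd_sum)
  also have "(0 :: real^'n, (\<Sum>i\<in>UNIV. y $ i *\<^sub>R axis i 1)) = (\<Sum>i\<in>UNIV. y $ i *\<^sub>R (0, axis i 1))"
    by (simp add: prod_eq_iff fst_sum snd_sum)
  finally show ?thesis
    by (simp add: D.sum linear_simps(5)[OF D.bounded_linear_axioms] del: scaleR_Pair)
qed

text \<open>Euler's theorem on homogeneous functions.\<close>

lemma euler_homogeneous:
  fixes L :: "'a::real_normed_vector \<times> 'b::real_normed_vector \<Rightarrow> real"
  assumes "(L has_derivative D) (at (x, y))"
    and hom: "\<And>r. r > 0 \<Longrightarrow> L (x, r *\<^sub>R y) = r\<^sup>2 * L (x, y)"
  shows "D (0, y) = 2 * L (x, y)"
proof -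
  have ray: "((\<lambda>r::real. (x, r *\<^sub>R y)) has_derivative (\<lambda>h. (0, h *\<^sub>R y))) (at 1)"
    by (auto intro!: derivative_eq_intros)
  have "((\<lambda>r. L (x, r *\<^sub>R y)) has_derivative (\<lambda>h. D (0, h *\<^sub>R y))) (at 1)"
    using has_derivative_compose[OF ray, of L D] assms(1) by simp
  then have "((\<lambda>r. r\<^sup>2 * L (x, y)) has_derivative (\<lambda>h. D (0, h *\<^sub>R y))) (at 1)"
    by (rule has_derivative_transform_within_open[of _ _ _ _ "{0<..}"]) (auto simp: hom)
  moreover have "((\<lambda>r. r\<^sup>2 * L (x, y)) has_derivative (\<lambda>h. h * (2 * L (x, y)))) (at 1)"
    by (auto intro!: derivative_eq_intros)
  ultimately have "(\<lambda>h. D (0, h *\<^sub>R y)) = (\<lambda>h. h * (2 * L (x, y)))"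
    by (rule has_derivative_unique)
  from fun_cong[OF this, of 1] show ?thesis by simp
qed

text \<open>The induced chart is compatible with scaling of tangent vectors, so the homogeneity of \<open>F\<close> is
  the homogeneity in \<open>y\<close> required by Euler's theorem.\<close>

lemma energy_eq_square:
  assumes fs: "finsler_space X A F" and c: "c \<in> A"
    and u: "u \<in> slit_tangent_bundle A" "fst u \<in> fst c"
  shows "energy A (\<lambda>w. (F w)\<^sup>2) c u = (F u)\<^sup>2"
proof -
  let ?L = "local_rep A c (\<lambda>w. (F w)\<^sup>2)"
  let ?z = "snd (induced_chart A c) u"
  have M: "smooth_manifold X A" and sm: "smooth_on_slit_in_chart A c F"
    and hom: "\<And>p v r. (p, v) \<in> tangent_bundle A \<Longrightarrow> r > 0 \<Longrightarrow> F (p, \<lambda>c. r *\<^sub>R v c) = r * F (p, v)"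
    using fs c unfolding finsler_space_def by auto
  obtain p v where pv: "u = (p, v)" by (cases u)
  have tb: "(p, v) \<in> tangent_bundle A" "p \<in> fst c"
    using u pv by (auto simp: slit_tangent_bundle_def)
  have z: "?z = (snd c p, v c)"
    using pv by (simp add: induced_chart_def)
  have "?L differentiable at ?z"
    unfolding local_rep_square using sm[unfolded smooth_on_slit_in_chart_def]
    by (rule smooth_square_differentiable(1))
       (use open_induced_chart_slit_image[OF M c] induced_chart_in_slit_image[OF u] in auto)
  then have D: "(?L has_derivative frechet_derivative ?L (at ?z)) (at ?z)"
    by (simp add: frechet_derivative_works)
  have "?L (snd c p, r *\<^sub>R v c) = r\<^sup>2 * ?L (snd c p, v c)" if "r > 0" for r
  proof -
    have "(p, \<lambda>c. r *\<^sub>R v c) \<in> tangent_bundle A"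
      using tb tangent_space_scale[OF M] by (auto simp: tangent_bundle_def)
    then have "?L (snd c p, r *\<^sub>R v c) = (F (p, \<lambda>c. r *\<^sub>R v c))\<^sup>2"
      using local_rep_induced_chart[OF M c, of "(p, \<lambda>c. r *\<^sub>R v c)" "\<lambda>w. (F w)\<^sup>2"] tb
      by (simp add: induced_chart_def)
    also have "\<dots> = r\<^sup>2 * (F (p, v))\<^sup>2"
      using hom[OF tb(1) that] by (simp add: power_mult_distrib)
    also have "(F (p, v))\<^sup>2 = ?L (snd c p, v c)"
      using local_rep_induced_chart[OF M c, of "(p, v)" "\<lambda>w. (F w)\<^sup>2"] tb
      by (simp add: induced_chart_def)
    finally show ?thesis .
  qed
  then have "frechet_derivative ?L (at ?z) (0, v c) = 2 * ?L ?z"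
    using D unfolding z by (intro euler_homogeneous) auto
  moreover have "?L ?z = (F u)\<^sup>2"
    using local_rep_induced_chart[OF M c, of u "\<lambda>w. (F w)\<^sup>2"] tb pv by simp
  moreover have "frechet_derivative ?L (at ?z) (0, v c) = (\<Sum>i\<in>UNIV. v c $ i * pd_y A c i (\<lambda>w. (F w)\<^sup>2) u)"
    using derivative_eq_sum_partials[OF D, of 0 "v c"] by (simp add: pd_y_def)
  ultimately show ?thesis
    using pv by (simp add: energy_def)
qed

section \<open>Variation of the energy along a curve\<close>

text \<open>The energy identity for an arbitrary Lagrangian \<open>L\<close>; the functions \<open>p i\<close> are the conjugate
  momenta \<open>\<partial>L/\<partial>y\<^sup>i\<close> along the curve.\<close>

lemma energy_derivative:
  fixes L :: "(real^'n) \<times> (real^'n) \<Rightarrow> real" and x y :: "real \<Rightarrow> real^'n"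
  assumes x: "(x has_vector_derivative y t) (at t)"
    and y: "(y has_vector_derivative y') (at t)"
    and L: "(L has_derivative D) (at (x t, y t))"
    and p: "\<And>i. (p i has_real_derivative p' i) (at t)" "\<And>i. p i t = D (0, axis i 1)"
  shows "((\<lambda>s. (\<Sum>i\<in>UNIV. y s $ i * p i s) - L (x s, y s)) has_real_derivative
    (\<Sum>i\<in>UNIV. y t $ i * (p' i - D (axis i 1, 0)))) (at t)"
proof -
  have D: "bounded_linear D"
    using L by (rule has_derivative_bounded_linear)
  have "((\<lambda>s. (x s, y s)) has_derivative (\<lambda>h. (h *\<^sub>R y t, h *\<^sub>R y'))) (at t)"
    using x y unfolding has_vector_derivative_def by (rule has_derivative_Pair)
  from has_derivative_compose[OF this L]
  have "((\<lambda>s. L (x s, y s)) has_derivative (\<lambda>h. D (h *\<^sub>R y t, h *\<^sub>R y'))) (at t)" .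
  moreover have "D (h *\<^sub>R y t, h *\<^sub>R y') = D (y t, y') * h" for h
    using linear_simps(5)[OF D, of h "(y t, y')"] by simp
  ultimately have dL: "((\<lambda>s. L (x s, y s)) has_real_derivative D (y t, y')) (at t)"
    by (simp add: has_field_derivative_def)
  have dy: "((\<lambda>s. y s $ i) has_real_derivative y' $ i) (at t)" for i
    using bounded_linear.has_vector_derivative[OF bounded_linear_vec_nth y]
    by (simp add: has_real_derivative_iff_has_vector_derivative)
  have "((\<lambda>s. (\<Sum>i\<in>UNIV. y s $ i * p i s) - L (x s, y s)) has_real_derivative
      (\<Sum>i\<in>UNIV. y' $ i * p i t + p' i * y t $ i) - D (y t, y')) (at t)"
    by (intro DERIV_diff DERIV_sum DERIV_mult dy p dL)
  moreover have "(\<Sum>i\<in>UNIV. y' $ i * p i t + p' i * y t $ i) - D (y t, y') =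
      (\<Sum>i\<in>UNIV. y t $ i * (p' i - D (axis i 1, 0)))"
    unfolding derivative_eq_sum_partials[OF L, of "y t"] p(2)
    by (simp add: right_diff_distrib sum.distrib sum_subtractf mult.commute)
  ultimately show ?thesis
    by simp
qed

lemma open_curve_in_chart:
  assumes "smooth_manifold X A" "C2_curve X A I \<gamma>" "c \<in> A"
  shows "open {t \<in> I. \<gamma> t \<in> fst c}"
proof -
  have "continuous_map (top_of_set I) X \<gamma>" "open I"
    using assms(2) by (auto simp: C2_curve_def)
  from openin_continuous_map_preimage[OF this(1) openin_chart_domain[OF assms(1,3)]]
  show ?thesis
    using \<open>open I\<close> by (auto simp: openin_open_eq)
qed

text \<open>The velocity is the Frechet derivative in the direction 1, so twofold differentiability of a
  curve on an open set in the sense of \<open>Ck_on\<close> gives derivatives of position and velocity.\<close>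

lemma C2_on_has_vector_derivatives:
  fixes x :: "real \<Rightarrow> 'b::real_normed_vector"
  assumes "Ck_on 2 x T" "open T" "t \<in> T"
  shows "(x has_vector_derivative vector_derivative x (at t)) (at t)"
    and "((\<lambda>s. vector_derivative x (at s)) has_vector_derivative
      vector_derivative (\<lambda>s. vector_derivative x (at s)) (at t)) (at t)"
proof -
  have 2: "Ck_on (Suc (Suc 0)) x T"
    using assms(1) by (simp only: numeral_2_eq_2)
  have d: "x differentiable at s" if "s \<in> T" for s
    using Ck_on_Suc_has_derivative[OF 2 assms(2) that] by (rule differentiableI)
  show "(x has_vector_derivative vector_derivative x (at t)) (at t)"
    using d[OF assms(3)] by (simp add: vector_derivative_works)
  have "Ck_on (Suc 0) (\<lambda>s. frechet_derivative x (at s) 1) T"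
    by (rule Ck_on_Suc_directional[OF 2])
  from Ck_on_Suc_has_derivative[OF this assms(2,3)]
  have "((\<lambda>s. vector_derivative x (at s)) has_derivative
      frechet_derivative (\<lambda>s. frechet_derivative x (at s) 1) (at t)) (at t)"
    by (rule has_derivative_transform_within_open[OF _ assms(2,3)])
       (simp add: frechet_derivative_eq_vector_derivative d)
  then have "(\<lambda>s. vector_derivative x (at s)) differentiable at t"
    by (rule differentiableI)
  then show "((\<lambda>s. vector_derivative x (at s)) has_vector_derivative
      vector_derivative (\<lambda>s. vector_derivative x (at s)) (at t)) (at t)"
    by (simp add: vector_derivative_works)
qed

theorem theorem2p2p3:
  fixes X :: "'a topology"
    and A :: "('a, real^'n) chart set"
    and F :: "('a, real^'n) tpoint \<Rightarrow> real"
    and Fe :: "('a, real^'n) tpoint \<Rightarrow>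
                 (('a, real^'n) tpoint, (real^'n) \<times> (real^'n)) tvec"
    and I :: "real set"
    and \<gamma> :: "real \<Rightarrow> 'a"
  assumes "finslerian_mechanical_system X A F Fe"
    and "evolution_curve X A F Fe I \<gamma>"
    and "t \<in> I" and "c \<in> A" and "\<gamma> t \<in> fst c"
  shows "energy A (\<lambda>w. (F w)\<^sup>2) c (lift A \<gamma> t) = (F (lift A \<gamma> t))\<^sup>2 \<and>
    ((\<lambda>s. energy A (\<lambda>w. (F w)\<^sup>2) c (lift A \<gamma> s)) has_real_derivative
      (\<Sum>i\<in>UNIV. vector_derivative (snd c \<circ> \<gamma>) (at t) $ i * force_cov A F Fe c i (lift A \<gamma> t)))
      (at t)"
proof
  let ?F2 = "\<lambda>w. (F w)\<^sup>2"
  let ?L = "local_rep A c ?F2"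
  define x where "x = snd c \<circ> \<gamma>"
  define y where "y = (\<lambda>s. vector_derivative x (at s))"
  define T where "T = {t \<in> I. \<gamma> t \<in> fst c}"
  define S where "S = snd (induced_chart A c) ` (fst (induced_chart A c) \<inter> slit_tangent_bundle A)"
  define p where "p = (\<lambda>i s. frechet_derivative ?L (at (x s, y s)) (0, axis i 1))"
  have fs: "finsler_space X A F" and M: "smooth_manifold X A"
    and sm: "smooth_on (local_rep A c F) S"
    using assms(1,4)
    unfolding finslerian_mechanical_system_def finsler_space_def smooth_on_slit_in_chart_def S_def
    by auto
  have curve: "C2_curve X A I \<gamma>"
    and slit: "\<And>s. s \<in> T \<Longrightarrow> lift A \<gamma> s \<in> slit_tangent_bundle A"
    and lagrange: "\<And>i. deriv (\<lambda>s. pd_y A c i ?F2 (lift A \<gamma> s)) t - pd_x A c i ?F2 (lift A \<gamma> t)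
          = force_cov A F Fe c i (lift A \<gamma> t)"
    using assms(2-5) unfolding evolution_curve_def T_def by auto
  have T: "open T" "t \<in> T"
    using open_curve_in_chart[OF M curve assms(4)] assms(3,5) by (auto simp: T_def)
  have S: "open S"
    using open_induced_chart_slit_image[OF M assms(4)] by (simp add: S_def)
  have dx: "(x has_vector_derivative y t) (at t)"
    and dy: "(y has_vector_derivative vector_derivative y (at t)) (at t)"
    using C2_on_has_vector_derivatives[of x T t] T curve assms(4)
    by (auto simp: C2_curve_def x_def y_def T_def)
  have lift: "fst (lift A \<gamma> s) \<in> fst c" "snd (lift A \<gamma> s) c = y s"
    "snd (induced_chart A c) (lift A \<gamma> s) = (x s, y s)" if "s \<in> T" for s
    using that assms(4) by (auto simp: lift_def induced_chart_def x_def y_def T_def)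
  have inS: "(x s, y s) \<in> S" if "s \<in> T" for s
    using induced_chart_in_slit_image[OF slit lift(1)] lift(3) that unfolding S_def by metis
  have pd_y: "pd_y A c i ?F2 (lift A \<gamma> s) = p i s" if "s \<in> T" for i s
    using lift(3)[OF that] by (simp add: pd_y_def p_def)
  have energy: "energy A ?F2 c (lift A \<gamma> s) = (\<Sum>i\<in>UNIV. y s $ i * p i s) - ?L (x s, y s)"
    if "s \<in> T" for s
    using local_rep_induced_chart[OF M assms(4), of "lift A \<gamma> s" ?F2] slit[OF that] lift[OF that]
      pd_y[OF that]
    by (simp add: energy_def slit_tangent_bundle_def)

  show "energy A ?F2 c (lift A \<gamma> t) = (F (lift A \<gamma> t))\<^sup>2"
    using energy_eq_square[OF fs assms(4) slit lift(1)] T(2) by blast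

  have dL: "(?L has_derivative frechet_derivative ?L (at (x t, y t))) (at (x t, y t))"
    unfolding local_rep_square
    by (rule iffD1[OF frechet_derivative_works smooth_square_differentiable(1)[OF sm S inS[OF T(2)]]])
  have dp: "(p i has_real_derivative deriv (p i) t) (at t)" for i
  proof -
    have "(\<lambda>z. frechet_derivative ?L (at z) (0, axis i 1)) differentiable at (x t, y t)"
      unfolding local_rep_square by (rule smooth_square_differentiable(2)[OF sm S inS[OF T(2)]])
    moreover have "(\<lambda>s. (x s, y s)) differentiable at t"
      using has_derivative_Pair dx dy unfolding has_vector_derivative_def
      by (blast intro: differentiableI)
    ultimately have "p i differentiable at t"
      unfolding p_def using differentiable_chain_at[of "\<lambda>s. (x s, y s)" t] by (simp add: o_def)
    then show ?thesis
      by (simp add: DERIV_deriv_iff_real_differentiable)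
  qed
  have "deriv (\<lambda>s. pd_y A c i ?F2 (lift A \<gamma> s)) t = deriv (p i) t" for i
    using pd_y T by (intro deriv_cong_ev) (auto simp: eventually_nhds)
  then have force: "deriv (p i) t - frechet_derivative ?L (at (x t, y t)) (axis i 1, 0) =
      force_cov A F Fe c i (lift A \<gamma> t)" for i
    using lagrange[of i] lift(3)[OF T(2)] by (simp add: pd_x_def)
  have "((\<lambda>s. (\<Sum>i\<in>UNIV. y s $ i * p i s) - ?L (x s, y s)) has_real_derivative
      (\<Sum>i\<in>UNIV. y t $ i *
        (deriv (p i) t - frechet_derivative ?L (at (x t, y t)) (axis i 1, 0)))) (at t)"
    by (rule energy_derivative[OF dx dy dL dp]) (simp add: p_def)
  then have "((\<lambda>s. energy A ?F2 c (lift A \<gamma> s)) has_real_derivative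
      (\<Sum>i\<in>UNIV. y t $ i * force_cov A F Fe c i (lift A \<gamma> t))) (at t)"
    unfolding force
    by (rule has_field_derivative_transform_within_open[OF _ T]) (simp add: energy)
  then show "((\<lambda>s. energy A ?F2 c (lift A \<gamma> s)) has_real_derivative
      (\<Sum>i\<in>UNIV. vector_derivative (snd c \<circ> \<gamma>) (at t) $ i * force_cov A F Fe c i (lift A \<gamma> t))) (at t)"
    by (simp add: y_def x_def)
qed

end
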